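(* Let $\sigma$ be a switch table for permutations in $\mathrm{Sym}(n)$ (for a group of order $k$) with maximal effective row $r$ and $c_i$ non-trivial switches in row $i$ for $i=1,2,\dots,r$. Let $B_j=\{0,1\}^j$ be the set of all branch-selection vectors of length $j$. Then the typical number $E_{\mathrm{mst}}(m)$ of single-element evaluations of the modified switch-table method for two independently random $m$-subsets $S,S'$ of $[n]$ is $$E_{\mathrm{mst}}(m)=\Bigl(\sum_{b\in B_r}w_{1,m}(b)\,\nu_m(b)\Bigr)k+\sum_{j=1}^{r}\Bigl(\Bigl(\sum_{b\in B_j}w_{1,m}(b)\,\nu_m(b)\Bigr)\frac{c_j}{c_j+1}\cdot\frac{k}{\kappa_{j+1}}\Bigr).$$
   Context: Throughout $1\le m<n$, $[n]=\{1,\dots,n\}$. Switch tables. For a subgroup $G\le\mathrm{Sym}(n)$ of order $k$, a switch table is a map $(i,j)\mapsto\sigma_{i,j}\in G$ on $[n]\times[n]$ such that for $j>i$, if some $g\in G$ has $g(j)=i$ and $g(t)=t$ for all $t<i$, then $\sigma_{i,j}$ is one such $g$; otherwise $\sigma_{i,j}=\mathrm{id}$. Non-identity entries are non-trivial; a row is effective if it has a non-trivial entry; $r$ is the largest index of an effective row; $J(i)$ is the set of columns of non-trivial entries in row $i$ and $c_i=|J(i)|$. One has $k=\prod_{j=1}^r(c_j+1)$. Parameters. $\kappa_i:=\prod_{j=i}^{r}(c_j+1)$ (so $\kappa_1=k$, $\kappa_{r+1}=1$). For $0<\ell<n-i+1$: $\rho_i(\ell):=\frac{\ell}{n-i+1}$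 and $\bar\rho_i(\ell):=1-\rho_i(\ell)$; for $\ell\le0$ or $\ell\ge n-i+1$: $\rho_i(\ell):=\bar\rho_i(\ell):=0$. With $(x)_\ell:=x(x-1)\cdots(x-\ell+1)$, the transitivity gap is $\gamma_i(\ell):=\frac{(n-i+1-(c_i+1))_\ell}{(n-i+1)_\ell}$ for $0\le\ell\le n-i-c_i$ and $\gamma_i(\ell):=0$ for $\ell>n-i-c_i$. Reduction factors: $\alpha^{(1)}_i(\ell):=\rho_i(\ell)^2$ (element branch), $\alpha^{(0)}_i(\ell):=\bar\rho_i(\ell)\,\gamma_i(\ell)$ (non-element branch; equal to $0$ for $\ell\le 0$). For $b=(b_1,\dots,b_p)\in\{0,1\}^p$ let $|b|$ be its number of ones and $|b|_{<t}$ the number of ones among its first $t-1$ coordinates. Branch weight: $w_{i,\ell}(b):=\prod_{t=1}^{p}\alpha^{(b_t)}_{i+t-1}(\ell-|b|_{<t})$ (empty product $=1$). Node weight: $\nu_\ell(b):=\max(\ell-|b|,0)$. Modified switch-table method and cost. A call at level $i$ takes subsets $S,S'\subseteq\{i,\dots,n\}$ with $|S|=|S'|=\ell$; it is started at level $1$ with $\ell=m$. If $\ell=0$, or $i\le r$ and $\ell=n-i+1$, it returns at no cost. If $i=r+1$ and $\ell\ge1$, $S$ and $S'$ are compared lexicographically, counted as $\ell$ single-element evaluations. Otherwise: (element branch, $i\in S$) if $i\in S'$, make a call at level $i+1$ with $S\setminus\{i\},S'\setminus\{i\}$; and for each $j\in J(i)\cap S'$ compute $\sigma_{i,j}(S'\setminus\{j\})$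 ($\ell-1$ evaluations) and make a call at level $i+1$ with $S\setminus\{i\}$ and this image; (non-element branch, $i\notin S$) if $i\in S'$ or $J(i)\cap S'\ne\emptyset$, return at no cost; otherwise make a call at level $i+1$ with $S,S'$, and for each $j\in J(i)$ compute $\sigma_{i,j}(S')$ ($\ell$ evaluations) and make a call at level $i+1$ with $S$ and this image. For the analysis, a negative answer of a recursive call does not stop the algorithm; all branches are carried out. Typical number: the expected total number of evaluations in the paper's simplified ("hyper-amortized") uniform model, in which in every call at level $i$ with cardinality $\ell$ the two subsets are regarded as independent and uniformly random $\ell$-subsets of $\{i,\dots,n\}$, disregarding their dependence on the subsets of earlier calls. *)

theory Defs
  imports "HOL-Probability.Probability" "HOL-Algebra.Sym_Groups"
begin

section \<open>Switch tables\<close>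

text \<open>
  \<open>Sym(n)\<close> is the library's \<^const>\<open>sym_group\<close>, whose elements are the functions permuting
  \<open>{1..n}\<close> (and fixing every other natural number).  Only the entries of a table on
  \<open>{1..n} \<times> {1..n}\<close> matter.
\<close>

definition switch_table :: "nat \<Rightarrow> (nat \<Rightarrow> nat) set \<Rightarrow> (nat \<Rightarrow> nat \<Rightarrow> nat \<Rightarrow> nat) \<Rightarrow> bool" where
  "switch_table n G \<sigma> \<longleftrightarrow>
     (\<forall>i\<in>{1..n}. \<forall>j\<in>{1..n}.
        if i < j \<and> (\<exists>g\<in>G. g j = i \<and> (\<forall>t\<in>{1..<i}. g t = t))
        then \<sigma> i j \<in> G \<and> \<sigma> i j j = i \<and> (\<forall>t\<in>{1..<i}. \<sigma> i j t = t)
        else \<sigma> i j = id)"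

definition row_switches :: "nat \<Rightarrow> (nat \<Rightarrow> nat \<Rightarrow> nat \<Rightarrow> nat) \<Rightarrow> nat \<Rightarrow> nat set" where
  "row_switches n \<sigma> i = {j\<in>{1..n}. \<sigma> i j \<noteq> id}"

abbreviation row_count :: "nat \<Rightarrow> (nat \<Rightarrow> nat \<Rightarrow> nat \<Rightarrow> nat) \<Rightarrow> nat \<Rightarrow> nat" where
  "row_count n \<sigma> i \<equiv> card (row_switches n \<sigma> i)"

text \<open>The inserted \<open>0\<close> is the value for the trivial group, whose table has no effective row.\<close>

definition max_effective_row :: "nat \<Rightarrow> (nat \<Rightarrow> nat \<Rightarrow> nat \<Rightarrow> nat) \<Rightarrow> nat" where
  "max_effective_row n \<sigma> = Max (insert 0 {i\<in>{1..n}. row_switches n \<sigma> i \<noteq> {}})"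

section \<open>Branch weights\<close>

definition kappa :: "nat \<Rightarrow> (nat \<Rightarrow> nat \<Rightarrow> nat \<Rightarrow> nat) \<Rightarrow> nat \<Rightarrow> nat" where
  "kappa n \<sigma> i = (\<Prod>j\<in>{i..max_effective_row n \<sigma>}. row_count n \<sigma> j + 1)"

text \<open>Cardinalities \<open>l\<close> are integers here, since \<open>l - |b|\<close> may be negative.\<close>

definition rho :: "nat \<Rightarrow> nat \<Rightarrow> int \<Rightarrow> real" where
  "rho n i l =
     (if 0 < l \<and> l < int n - int i + 1 then of_int l / (real n - real i + 1) else 0)"

definition rho_bar :: "nat \<Rightarrow> nat \<Rightarrow> int \<Rightarrow> real" where
  "rho_bar n i l = (if 0 < l \<and> l < int n - int i + 1 then 1 - rho n i l else 0)"

definition falling_factorial :: "real \<Rightarrow> nat \<Rightarrow> real" where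
  "falling_factorial x l = (\<Prod>s<l. x - real s)"

text \<open>The value for \<open>l < 0\<close> is irrelevant: \<open>\<gamma>\<close> only occurs multiplied by \<^const>\<open>rho_bar\<close>.\<close>

definition transitivity_gap :: "nat \<Rightarrow> (nat \<Rightarrow> nat \<Rightarrow> nat \<Rightarrow> nat) \<Rightarrow> nat \<Rightarrow> int \<Rightarrow> real" where
  "transitivity_gap n \<sigma> i l =
     (if 0 \<le> l \<and> l \<le> int n - int i - int (row_count n \<sigma> i)
      then falling_factorial (real n - real i + 1 - (real (row_count n \<sigma> i) + 1)) (nat l)
           / falling_factorial (real n - real i + 1) (nat l)
      else 0)"

definition reduction_factor ::
    "nat \<Rightarrow> (nat \<Rightarrow> nat \<Rightarrow> nat \<Rightarrow> nat) \<Rightarrow> bool \<Rightarrow> nat \<Rightarrow> int \<Rightarrow> real" where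
  "reduction_factor n \<sigma> \<beta> i l =
     (if \<beta> then (rho n i l)\<^sup>2 else rho_bar n i l * transitivity_gap n \<sigma> i l)"

text \<open>
  Branch-selection vectors in \<open>{0,1}\<^sup>p\<close> are Boolean lists of length \<open>p\<close>, with \<^const>\<open>True\<close> for \<open>1\<close>
  (element branch); the coordinate \<open>b\<^sub>t\<close> is \<open>b ! (t - 1)\<close>.
\<close>

definition branch_vectors :: "nat \<Rightarrow> bool list set" where
  "branch_vectors p = {b. length b = p}"

definition ones :: "bool list \<Rightarrow> nat" where
  "ones b = count_list b True"

definition branch_weight ::
    "nat \<Rightarrow> (nat \<Rightarrow> nat \<Rightarrow> nat \<Rightarrow> nat) \<Rightarrow> nat \<Rightarrow> int \<Rightarrow> bool list \<Rightarrow> real" where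
  "branch_weight n \<sigma> i l b =
     (\<Prod>t\<in>{1..length b}.
        reduction_factor n \<sigma> (b ! (t - 1)) (i + t - 1) (l - int (ones (take (t - 1) b))))"

definition node_weight :: "int \<Rightarrow> bool list \<Rightarrow> int" where
  "node_weight l b = max (l - int (ones b)) 0"

section \<open>The modified switch-table method\<close>

text \<open>
  A call at level \<open>i\<close> is given by the pair \<open>(S, S')\<close>.  The number of single-element evaluations it
  makes itself and the arguments of the calls at level \<open>i + 1\<close> which it issues are described
  separately.  Answers of recursive calls play no role, as all branches are carried out.
\<close>

definition returns_at_once ::
    "nat \<Rightarrow> (nat \<Rightarrow> nat \<Rightarrow> nat \<Rightarrow> nat) \<Rightarrow> nat \<Rightarrow> nat set \<Rightarrow> bool" where
  "returns_at_once n \<sigma> i S \<longleftrightarrow>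
     card S = 0 \<or> (i \<le> max_effective_row n \<sigma> \<and> card S = n - i + 1)"

definition mst_evals ::
    "nat \<Rightarrow> (nat \<Rightarrow> nat \<Rightarrow> nat \<Rightarrow> nat) \<Rightarrow> nat \<Rightarrow> nat set \<Rightarrow> nat set \<Rightarrow> nat" where
  "mst_evals n \<sigma> i S S' =
     (let J = row_switches n \<sigma> i; l = card S in
      if returns_at_once n \<sigma> i S then 0
      else if max_effective_row n \<sigma> < i then l
      else if i \<in> S then (\<Sum>j\<in>J \<inter> S'. l - 1)
      else if i \<in> S' \<or> J \<inter> S' \<noteq> {} then 0
      else (\<Sum>j\<in>J. l))"

definition mst_calls ::
    "nat \<Rightarrow> (nat \<Rightarrow> nat \<Rightarrow> nat \<Rightarrow> nat) \<Rightarrow> nat \<Rightarrow> nat set \<Rightarrow> nat set \<Rightarrow> (nat set \<times> nat set) list" where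
  "mst_calls n \<sigma> i S S' =
     (let J = row_switches n \<sigma> i in
      if returns_at_once n \<sigma> i S \<or> max_effective_row n \<sigma> < i then []
      else if i \<in> S then
        (if i \<in> S' then [(S - {i}, S' - {i})] else [])
        @ map (\<lambda>j. (S - {i}, \<sigma> i j ` (S' - {j}))) (sorted_list_of_set (J \<inter> S'))
      else if i \<in> S' \<or> J \<inter> S' \<noteq> {} then []
      else (S, S') # map (\<lambda>j. (S, \<sigma> i j ` S')) (sorted_list_of_set J))"

section \<open>The uniform model\<close>

definition level_subsets :: "nat \<Rightarrow> nat \<Rightarrow> nat \<Rightarrow> nat set set" where
  "level_subsets n i l = {S. S \<subseteq> {i..n} \<and> card S = l}"

definition sum_list_pmf :: "nat pmf list \<Rightarrow> nat pmf" where
  "sum_list_pmf ps =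
     foldr (\<lambda>p q. map_pmf (\<lambda>(x, y). x + y) (pair_pmf p q)) ps (return_pmf 0)"

text \<open>
  The distribution of the total number of evaluations caused by a call at level \<open>i\<close> with
  cardinality \<open>l\<close>.  Each call draws a fresh independent pair of uniformly random subsets; of the
  arguments \<open>(U, U')\<close> passed by the calling instance only the cardinality is retained.
\<close>

function mst_cost :: "nat \<Rightarrow> (nat \<Rightarrow> nat \<Rightarrow> nat \<Rightarrow> nat) \<Rightarrow> nat \<Rightarrow> nat \<Rightarrow> nat pmf" where
  "mst_cost n \<sigma> i l =
     do {
       (S, S') \<leftarrow> pair_pmf (pmf_of_set (level_subsets n i l)) (pmf_of_set (level_subsets n i l));
       rest \<leftarrow> (if max_effective_row n \<sigma> < i then return_pmf 0
                else sum_list_pmf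
                       (map (\<lambda>(U, U'). mst_cost n \<sigma> (i + 1) (card U)) (mst_calls n \<sigma> i S S')));
       return_pmf (mst_evals n \<sigma> i S S' + rest)
     }"
  by pat_completeness auto
termination
  by (relation "Wellfounded.measure (\<lambda>(n, \<sigma>, i, l). Suc (max_effective_row n \<sigma>) - i)") auto

declare mst_cost.simps [simp del]

definition typical_evals :: "nat \<Rightarrow> (nat \<Rightarrow> nat \<Rightarrow> nat \<Rightarrow> nat) \<Rightarrow> nat \<Rightarrow> real" where
  "typical_evals n \<sigma> m = measure_pmf.expectation (mst_cost n \<sigma> 1 m) real"

end

theory Submission
  imports Defs
begin

text \<open>
  In the uniform model the mean cost \<open>E\<^sub>i(\<ell>)\<close> of a call satisfies
  \<open>E\<^sub>i(\<ell>) = \<alpha>\<^sup>1 ((c + 1) E\<^sub>i\<^sub>+\<^sub>1(\<ell> - 1) + c (\<ell> - 1)) + \<alpha>\<^sup>0 ((c + 1) E\<^sub>i\<^sub>+\<^sub>1(\<ell>) + c \<ell>)\<close>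
  with \<open>c = c\<^sub>i\<close>: an \<open>\<ell>\<close>-subset contains a given point with probability \<open>\<rho>\<close> and avoids \<open>{i} \<union> J(i)\<close>
  with probability \<open>\<gamma>\<close>. The claimed formula, generalised to an arbitrary starting level, solves the
  same recursion by splitting off the first coordinate of the branch vectors. Finally
  \<open>k = \<kappa>\<^sub>1\<close> by decomposing each pointwise stabilizer into cosets of the next one.
\<close>

section \<open>The order of the group\<close>

text \<open>The stabilizer chain of \<open>G\<close> along the base \<open>1, ..., n\<close>: it
  starts with \<open>G\<close> itself at \<open>i = 1\<close> and, for a subgroup of Sym(n), is
  trivial at \<open>i = n + 1\<close>.\<close>

definition stabilizer_level :: "(nat \<Rightarrow> nat) set \<Rightarrow> nat \<Rightarrow> (nat \<Rightarrow> nat) set" where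
  "stabilizer_level G i = {g\<in>G. \<forall>t\<in>{1..<i}. g t = t}"

text \<open>A chosen switch moves \<open>j\<close> to \<open>i < j\<close>, so it is never
  \<open>id\<close>; therefore the identity entries are exactly those of the else branch.\<close>

lemma switch_tableD:
  assumes "switch_table n G \<sigma>" "i \<in> {1..n}" "j \<in> {1..n}"
  shows "\<sigma> i j \<noteq> id \<longleftrightarrow> i < j \<and> (\<exists>g\<in>stabilizer_level G i. g j = i)"
    and "\<sigma> i j \<noteq> id \<Longrightarrow> \<sigma> i j \<in> stabilizer_level G i"
    and "\<sigma> i j \<noteq> id \<Longrightarrow> \<sigma> i j j = i"
proof -
  let ?P = "i < j \<and> (\<exists>g\<in>stabilizer_level G i. g j = i)"
  have "(i < j \<and> (\<exists>g\<in>G. g j = i \<and> (\<forall>t\<in>{1..<i}. g t = t))) = ?P"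
    unfolding stabilizer_level_def by blast
  then have *: "if ?P then \<sigma> i j \<in> G \<and> \<sigma> i j j = i \<and> (\<forall>t\<in>{1..<i}. \<sigma> i j t = t) else \<sigma> i j = id"
    using bspec[OF bspec[OF assms(1)[unfolded switch_table_def] assms(2)] assms(3)] by simp
  have yes: "\<sigma> i j \<in> stabilizer_level G i \<and> \<sigma> i j j = i" if ?P
    using * unfolding if_P[OF that] by (simp add: stabilizer_level_def)
  have no: "\<sigma> i j = id" if "\<not> ?P"
    using * unfolding if_not_P[OF that] .
  have "\<sigma> i j \<noteq> id" if ?P
  proof
    assume "\<sigma> i j = id"
    then show False
      using yes[OF that] that by simp
  qed
  then show iff: "\<sigma> i j \<noteq> id \<longleftrightarrow> ?P"
    using no by blast
  show "\<sigma> i j \<in> stabilizer_level G i" "\<sigma> i j j = i" if "\<sigma> i j \<noteq> id"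
    using yes iff that by blast+
qed

text \<open>For a group, this set together with \<open>i\<close> is the orbit of \<open>i\<close>
  under the stabilizer of the points below \<open>i\<close>; it depends on \<open>G\<close> alone
  and not on the switches chosen.\<close>

lemma row_switches_eq:
  assumes "switch_table n G \<sigma>" "i \<in> {1..n}"
  shows "row_switches n \<sigma> i = {j\<in>{i<..n}. \<exists>g\<in>stabilizer_level G i. g j = i}"
proof -
  have "{i<..n} \<subseteq> {1..n}"
    using assms(2) by auto
  moreover have "row_switches n \<sigma> i = {j\<in>{1..n}. i < j \<and> (\<exists>g\<in>stabilizer_level G i. g j = i)}"
    unfolding row_switches_def by (rule Collect_cong) (use switch_tableD(1)[OF assms] in blast)
  ultimately show ?thesis
    by auto
qed

lemma switch_in_stabilizer:
  assumes "switch_table n G \<sigma>" "i \<in> {1..n}" "j \<in> row_switches n \<sigma> i"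
  shows "\<sigma> i j \<in> stabilizer_level G i" "\<sigma> i j j = i"
  using switch_tableD(2,3)[OF assms(1,2)] assms(3) by (auto simp: row_switches_def)

lemma row_switches_subset:
  assumes "switch_table n G \<sigma>" "i \<in> {1..n}"
  shows "row_switches n \<sigma> i \<subseteq> {i<..n}"
  unfolding row_switches_eq[OF assms] by blast

lemma row_switches_beyond:
  assumes "i \<in> {1..n}" "max_effective_row n \<sigma> < i"
  shows "row_switches n \<sigma> i = {}"
proof (rule ccontr)
  assume "row_switches n \<sigma> i \<noteq> {}"
  then have "i \<le> max_effective_row n \<sigma>"
    unfolding max_effective_row_def using assms(1) by (intro Max_ge) auto
  then show False
    using assms(2) by simp
qed

text \<open>Switches lie strictly to the right of the diagonal, so row \<open>n\<close> is empty;
  \<open>0 < n\<close> covers the default value \<open>0\<close> of the maximum.\<close>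

lemma max_effective_row_less:
  assumes "switch_table n G \<sigma>" "0 < n"
  shows "max_effective_row n \<sigma> < n"
proof -
  have "i < n" if "i \<in> {1..n}" "row_switches n \<sigma> i \<noteq> {}" for i
    using row_switches_subset[OF assms(1) that(1)] that(2) by force
  then show ?thesis
    unfolding max_effective_row_def using assms(2) by (subst Max_less_iff) auto
qed

section \<open>Pointwise stabilizers and their cosets\<close>

lemma subgroup_sym_groupD:
  assumes "subgroup G (sym_group n)"
  shows "\<And>g. g \<in> G \<Longrightarrow> g permutes {1..n}"
    "id \<in> G"
    "\<And>g h. g \<in> G \<Longrightarrow> h \<in> G \<Longrightarrow> g \<circ> h \<in> G"
    "\<And>g. g \<in> G \<Longrightarrow> inv' g \<in> G"
proof -
  have carrier: "g \<in> carrier (sym_group n)" if "g \<in> G" for g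
    using subgroup.subset[OF assms] that by blast
  show "g permutes {1..n}" if "g \<in> G" for g
    using carrier[OF that] by (simp add: sym_group_def)
  show "id \<in> G"
    using subgroup.one_closed[OF assms] by (simp add: sym_group_def)
  show "g \<circ> h \<in> G" if "g \<in> G" "h \<in> G" for g h
    using subgroup.m_closed[OF assms that] by (simp add: sym_group_def)
  show "inv' g \<in> G" if "g \<in> G" for g
    using subgroup.m_inv_closed[OF assms that]
    unfolding sym_group_inv_equality[OF carrier[OF that]] .
qed

lemma stabilizer_level_group:
  assumes "subgroup G (sym_group n)"
  shows "id \<in> stabilizer_level G i"
    "\<And>g h. g \<in> stabilizer_level G i \<Longrightarrow> h \<in> stabilizer_level G i \<Longrightarrow> g \<circ> h \<in> stabilizer_level G i"
    "\<And>g. g \<in> stabilizer_level G i \<Longrightarrow> inv' g \<in> stabilizer_level G i"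
proof -
  note G = subgroup_sym_groupD[OF assms]
  show "id \<in> stabilizer_level G i"
    by (simp add: stabilizer_level_def G)
  show "g \<circ> h \<in> stabilizer_level G i"
    if "g \<in> stabilizer_level G i" "h \<in> stabilizer_level G i" for g h
    using that G by (simp add: stabilizer_level_def)
  show "inv' g \<in> stabilizer_level G i" if "g \<in> stabilizer_level G i" for g
    using that G(1,4)[of g] by (auto simp: stabilizer_level_def permutes_inv_eq)
qed

lemma stabilizer_level_Suc:
  "1 \<le> i \<Longrightarrow> g \<in> stabilizer_level G (Suc i) \<longleftrightarrow> g \<in> stabilizer_level G i \<and> g i = i"
  by (auto simp: stabilizer_level_def less_Suc_eq)

text \<open>The elements \<open>\<sigma> i j\<close> together with the identity are representatives of the right cosets of
  the next stabilizer.\<close>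

lemma card_stabilizer_level:
  assumes G: "subgroup G (sym_group n)" and st: "switch_table n G \<sigma>" and i: "i \<in> {1..n}"
  shows "card (stabilizer_level G i) =
    (row_count n \<sigma> i + 1) * card (stabilizer_level G (Suc i))"
proof -
  let ?J = "row_switches n \<sigma> i"
  define \<tau> where "\<tau> j = (if j = i then id else \<sigma> i j)" for j
  note grp = stabilizer_level_group[OF G]
  have perm: "g permutes {1..n}" if "g \<in> stabilizer_level G i'" for g i'
    using that subgroup_sym_groupD(1)[OF G] by (auto simp: stabilizer_level_def)
  have \<tau>: "\<tau> j \<in> stabilizer_level G i" "\<tau> j j = i" if "j \<in> insert i ?J" for j
    using that grp(1) switch_in_stabilizer[OF st i] by (auto simp: \<tau>_def)
  have H: "h \<in> stabilizer_level G i" "h i = i" if "h \<in> stabilizer_level G (Suc i)" for h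
    using that i by (auto simp: stabilizer_level_Suc)
  \<comment> \<open>Each \<open>\<tau> j\<close> sends \<open>j\<close> to \<open>i\<close> and each
    \<open>h\<close> fixes \<open>i\<close>, so the coset of a product is determined by the point
    that the product sends to \<open>i\<close>.\<close>
  have "bij_betw (\<lambda>(j, h). h \<circ> \<tau> j) (insert i ?J \<times> stabilizer_level G (Suc i))
      (stabilizer_level G i)"
    unfolding bij_betw_def
  proof (intro conjI inj_onI)
    fix x y
    assume x: "x \<in> insert i ?J \<times> stabilizer_level G (Suc i)"
      and y: "y \<in> insert i ?J \<times> stabilizer_level G (Suc i)"
      and eq: "(\<lambda>(j, h). h \<circ> \<tau> j) x = (\<lambda>(j, h). h \<circ> \<tau> j) y"
    obtain j h j' h' where xy: "x = (j, h)" "y = (j', h')"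
      by (cases x; cases y) auto
    have jh: "j \<in> insert i ?J" "h \<in> stabilizer_level G (Suc i)"
        "j' \<in> insert i ?J" "h' \<in> stabilizer_level G (Suc i)"
      using x y xy by auto
    have eq': "h \<circ> \<tau> j = h' \<circ> \<tau> j'"
      using eq xy by simp
    have "(h \<circ> \<tau> j) j = i" "(h' \<circ> \<tau> j') j' = i"
      using \<tau> H jh by auto
    moreover have "inj (h \<circ> \<tau> j)"
      using perm[OF grp(2)[OF H(1)[OF jh(2)] \<tau>(1)[OF jh(1)]]] by (rule permutes_inj)
    ultimately have "j = j'"
      using eq' by (metis injD)
    moreover have "surj (\<tau> j)"
      using perm[OF \<tau>(1)[OF jh(1)]] by (rule permutes_surj)
    ultimately have "h = h'"
      using eq' by (simp add: fun_eq_iff surj_def) metis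
    then show "x = y"
      using \<open>j = j'\<close> xy by simp
  next
    show "(\<lambda>(j, h). h \<circ> \<tau> j) ` (insert i ?J \<times> stabilizer_level G (Suc i)) = stabilizer_level G i"
    proof (intro equalityI subsetI)
      fix g assume "g \<in> (\<lambda>(j, h). h \<circ> \<tau> j) ` (insert i ?J \<times> stabilizer_level G (Suc i))"
      then obtain j h where "j \<in> insert i ?J" "h \<in> stabilizer_level G (Suc i)" "g = h \<circ> \<tau> j"
        by auto
      then show "g \<in> stabilizer_level G i"
        using grp(2)[OF H(1) \<tau>(1)] by simp
    next
      fix g assume g: "g \<in> stabilizer_level G i"
      \<comment> \<open>The preimage of \<open>i\<close> names the coset of \<open>g\<close>. It
        cannot lie below \<open>i\<close>, because \<open>g\<close> fixes those points, and
        \<open>g\<close> itself witnesses that it belongs to the row.\<close>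
      define j where "j = inv' g i"
      have gj: "g j = i"
        using permutes_inverses(1)[OF perm[OF g]] by (simp add: j_def)
      have "j \<in> {1..n}"
        unfolding j_def using permutes_in_image[OF permutes_inv[OF perm[OF g]]] i by blast
      moreover have "\<not> j < i"
      proof
        assume "j < i"
        then have "g j = j"
          using g \<open>j \<in> {1..n}\<close> by (auto simp: stabilizer_level_def)
        then show False
          using gj \<open>j < i\<close> by simp
      qed
      ultimately have j: "j \<in> insert i ?J"
        unfolding row_switches_eq[OF st i] using g gj by force
      note p\<tau> = perm[OF \<tau>(1)[OF j]]
      define h where "h = g \<circ> inv' (\<tau> j)"
      have "h \<in> stabilizer_level G i"
        unfolding h_def by (rule grp(2)[OF g grp(3)[OF \<tau>(1)[OF j]]])
      moreover have "inv' (\<tau> j) i = j"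
        using \<tau>(2)[OF j] permutes_inv_eq[OF p\<tau>] by simp
      then have "h i = i"
        by (simp add: h_def gj)
      ultimately have "h \<in> stabilizer_level G (Suc i)"
        using i by (simp add: stabilizer_level_Suc)
      moreover have "g = h \<circ> \<tau> j"
        by (simp add: h_def o_assoc[symmetric] permutes_inv_o[OF p\<tau>])
      ultimately show "g \<in> (\<lambda>(j, h). h \<circ> \<tau> j) ` (insert i ?J \<times> stabilizer_level G (Suc i))"
        using j by force
    qed
  qed
  then have "card (stabilizer_level G i) = card (insert i ?J \<times> stabilizer_level G (Suc i))"
    by (simp add: bij_betw_same_card)
  moreover have "i \<notin> ?J" "finite ?J"
    using row_switches_subset[OF st i] by (auto simp: row_switches_def)
  ultimately show ?thesis
    by (simp add: card_cartesian_product)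
qed

text \<open>Coset counts telescope down the stabilizer chain to the trivial group at level
  \<open>n + 1\<close>; rows after the last effective one contribute only factors 1.\<close>

lemma card_eq_kappa:
  assumes G: "subgroup G (sym_group n)" and st: "switch_table n G \<sigma>" and "0 < n"
  shows "card G = kappa n \<sigma> 1"
proof -
  let ?r = "max_effective_row n \<sigma>"
  note D = subgroup_sym_groupD[OF G]
  have "card G = (\<Prod>j\<in>{1..q}. row_count n \<sigma> j + 1) * card (stabilizer_level G (Suc q))"
    if "q \<le> n" for q
    using that
  proof (induction q)
    case 0
    then show ?case
      by (simp add: stabilizer_level_def)
  next
    case (Suc q)
    then have "card (stabilizer_level G (Suc q)) =
        (row_count n \<sigma> (Suc q) + 1) * card (stabilizer_level G (Suc (Suc q)))"
      by (intro card_stabilizer_level[OF G st]) simp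
    moreover have "(\<Prod>j\<in>{1..Suc q}. row_count n \<sigma> j + 1) =
        (\<Prod>j\<in>{1..q}. row_count n \<sigma> j + 1) * (row_count n \<sigma> (Suc q) + 1)"
      by simp
    ultimately show ?case
      using Suc by (simp only: mult.assoc Suc_leD)
  qed
  from this[of n]
  have "card G = (\<Prod>j\<in>{1..n}. row_count n \<sigma> j + 1) * card (stabilizer_level G (Suc n))"
    by simp
  also have "stabilizer_level G (Suc n) = {id}"
  proof (intro equalityI subsetI)
    fix g assume g: "g \<in> stabilizer_level G (Suc n)"
    then have "g permutes {1..n}"
      using D(1) by (auto simp: stabilizer_level_def)
    then have "g t = t" for t
      using g permutes_not_in by (cases "t \<in> {1..n}") (fastforce simp: stabilizer_level_def)+
    then show "g \<in> {id}"
      by (simp add: fun_eq_iff)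
  qed (use stabilizer_level_group(1)[OF G] in blast)
  also have "(\<Prod>j\<in>{1..n}. row_count n \<sigma> j + 1) = (\<Prod>j\<in>{1..?r}. row_count n \<sigma> j + 1)"
    using max_effective_row_less[OF st \<open>0 < n\<close>] row_switches_beyond
    by (intro prod.mono_neutral_right) auto
  finally show ?thesis
    by (simp add: kappa_def)
qed

section \<open>Counting subsets of fixed cardinality\<close>

lemma card_level_subsets: "card (level_subsets n i l) = (Suc n - i) choose l"
  unfolding level_subsets_def by (subst n_subsets) auto

lemma finite_level_subsets [simp]: "finite (level_subsets n i l)"
  by (rule finite_subset[of _ "Pow {i..n}"]) (auto simp: level_subsets_def)

text \<open>Deleting \<open>x\<close> leaves an arbitrary \<open>(l - 1)\<close>-subset of the other
  points, and the absorption identity for binomials turns the count into the fraction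
  \<open>l / (n - i + 1)\<close>.\<close>

lemma card_level_subsets_member:
  assumes "x \<in> {i..n}"
  shows "real (card {S\<in>level_subsets n i l. x \<in> S}) =
    real l / real (Suc n - i) * real (card (level_subsets n i l))"
proof (cases l)
  case 0
  then show ?thesis
    using finite_subset[OF _ finite_atLeastAtMost[of i n]]
    by (auto simp: level_subsets_def)
next
  case (Suc l')
  define N' where "N' = n - i"
  have N: "Suc n - i = Suc N'"
    using assms by (simp add: N'_def Suc_diff_le)
  have "bij_betw (insert x) {T. T \<subseteq> {i..n} - {x} \<and> card T = l'} {S\<in>level_subsets n i l. x \<in> S}"
  proof (rule bij_betwI[where g = "\<lambda>S. S - {x}"])
    show "insert x \<in> {T. T \<subseteq> {i..n} - {x} \<and> card T = l'} \<rightarrow> {S\<in>level_subsets n i l. x \<in> S}"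
    proof
      fix T assume T: "T \<in> {T. T \<subseteq> {i..n} - {x} \<and> card T = l'}"
      then have "finite T" "x \<notin> T"
        using finite_subset by blast+
      then show "insert x T \<in> {S\<in>level_subsets n i l. x \<in> S}"
        using T assms Suc by (auto simp: level_subsets_def)
    qed
  qed (use Suc in \<open>auto simp: level_subsets_def\<close>)
  then have "card {S\<in>level_subsets n i l. x \<in> S} = card {T. T \<subseteq> {i..n} - {x} \<and> card T = l'}"
    by (simp add: bij_betw_same_card)
  also have "\<dots> = N' choose l'"
    using assms N by (subst n_subsets) (auto simp: N'_def)
  finally have "card {S\<in>level_subsets n i l. x \<in> S} = N' choose l'" .
  moreover have "real (Suc l') * real (Suc N' choose Suc l') = real (Suc N') * real (N' choose l')"
    using Suc_times_binomial_eq[of N' l'] by (metis mult.commute of_nat_mult)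
  ultimately show ?thesis
    unfolding card_level_subsets N Suc
    by (simp add: field_simps del: binomial_Suc_Suc of_nat_Suc)
qed

text \<open>Linearity of expectation over the points of \<open>K\<close>, in unnormalized
  form.\<close>

lemma sum_card_Int_level_subsets:
  assumes "K \<subseteq> {i..n}"
  shows "(\<Sum>S\<in>level_subsets n i l. real (card (K \<inter> S))) =
    real (card K) * (real l / real (Suc n - i)) * real (card (level_subsets n i l))"
proof -
  have fin: "finite K"
    using assms finite_subset by blast
  have "(\<Sum>S\<in>level_subsets n i l. real (card (K \<inter> S))) =
      (\<Sum>S\<in>level_subsets n i l. \<Sum>x\<in>K. of_bool (x \<in> S))"
    using fin by (simp add: Int_def)
  also have "\<dots> = (\<Sum>x\<in>K. real (card {S\<in>level_subsets n i l. x \<in> S}))"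
    by (subst sum.swap) (simp add: Int_def)
  also have "\<dots> = (\<Sum>x\<in>K. real l / real (Suc n - i) * real (card (level_subsets n i l)))"
    using assms by (intro sum.cong card_level_subsets_member) auto
  finally show ?thesis
    by simp
qed

text \<open>In a quotient of two such factorials \<open>fact l\<close> cancels, so the transitivity
  gap becomes a quotient of binomials.\<close>

lemma falling_factorial_of_nat: "falling_factorial (real a) l = fact l * real (a choose l)"
  by (simp add: falling_factorial_def binomial_gbinomial gbinomial_prod_rev atLeast0LessThan)

text \<open>The subset must be chosen among the \<open>n - i - c\<close> points outside
  \<open>{i}\<close> and the row. The bound on \<open>l\<close> keeps the denominator of the gap
  nonzero.\<close>

lemma card_level_subsets_disjoint:
  assumes "row_switches n \<sigma> i \<subseteq> {i<..n}" "i \<le> n" "l \<le> Suc n - i"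
  shows "real (card {S\<in>level_subsets n i l. insert i (row_switches n \<sigma> i) \<inter> S = {}}) =
    transitivity_gap n \<sigma> i (int l) * real (card (level_subsets n i l))"
proof -
  let ?J = "row_switches n \<sigma> i"
  have fin: "finite ?J" "i \<notin> ?J"
    using assms by (auto simp: row_switches_def)
  have "card ?J \<le> card {i<..n}"
    using assms by (intro card_mono) auto
  then have c: "card ?J \<le> n - i"
    by simp
  have "{S\<in>level_subsets n i l. insert i ?J \<inter> S = {}} =
      {S. S \<subseteq> {i..n} - insert i ?J \<and> card S = l}"
    by (auto simp: level_subsets_def)
  moreover have "card ({i..n} - insert i ?J) = n - i - card ?J"
    using assms fin by (subst card_Diff_subset) auto
  ultimately have card: "card {S\<in>level_subsets n i l. insert i ?J \<inter> S = {}} =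
      (n - i - card ?J) choose l"
    by (simp add: n_subsets)
  show ?thesis
  proof (cases "l \<le> n - i - card ?J")
    case True
    \<comment> \<open>Since \<open>c \<le> n - i\<close>, natural subtraction is exact and the
      arguments of the factorials are natural numbers.\<close>
    have "real n - real i + 1 - (real (card ?J) + 1) = real (n - i - card ?J)"
      "real n - real i + 1 = real (Suc n - i)"
      using c assms by auto
    moreover have "int l \<le> int n - int i - int (card ?J)"
      using True c assms by linarith
    ultimately have "transitivity_gap n \<sigma> i (int l) =
        real (n - i - card ?J choose l) / real (Suc n - i choose l)"
      by (simp only: transitivity_gap_def falling_factorial_of_nat nat_int) simp
    moreover have "0 < Suc n - i choose l"
      using assms by (simp add: zero_less_binomial)
    ultimately show ?thesis
      unfolding card by (simp add: card_level_subsets)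
  next
    \<comment> \<open>The binomial vanishes here, in agreement with the default value 0 of the
      gap.\<close>
    case False
    then have "\<not> int l \<le> int n - int i - int (card ?J)"
      by linarith
    then show ?thesis
      using False unfolding card by (simp add: transitivity_gap_def)
  qed
qed

section \<open>The expected cost\<close>

abbreviation mean :: "nat pmf \<Rightarrow> real" where
  "mean p \<equiv> measure_pmf.expectation p real"

lemma finite_sum_list_pmf:
  "(\<And>p. p \<in> set ps \<Longrightarrow> finite (set_pmf p)) \<Longrightarrow> finite (set_pmf (sum_list_pmf ps))"
  by (induction ps) (auto simp: sum_list_pmf_def)

text \<open>Linearity of expectation: each summand depends on one marginal of the product, and
  finite support supplies integrability.\<close>

lemma mean_sum_list_pmf:
  assumes "\<And>p. p \<in> set ps \<Longrightarrow> finite (set_pmf p)"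
  shows "mean (sum_list_pmf ps) = sum_list (map mean ps)"
  using assms
proof (induction ps)
  case Nil
  then show ?case
    by (simp add: sum_list_pmf_def)
next
  case (Cons p ps)
  let ?q = "sum_list_pmf ps"
  have fin: "finite (set_pmf (pair_pmf p ?q))"
    using Cons.prems finite_sum_list_pmf[of ps] by auto
  have "mean (sum_list_pmf (p # ps)) =
      measure_pmf.expectation (pair_pmf p ?q) (\<lambda>x. real (fst x) + real (snd x))"
    by (simp add: sum_list_pmf_def case_prod_beta)
  also have "\<dots> = measure_pmf.expectation (pair_pmf p ?q) (\<lambda>x. real (fst x))
      + measure_pmf.expectation (pair_pmf p ?q) (\<lambda>x. real (snd x))"
    by (intro Bochner_Integration.integral_add integrable_measure_pmf_finite fin)
  also have "measure_pmf.expectation (pair_pmf p ?q) (\<lambda>x. real (fst x)) =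
      mean (map_pmf fst (pair_pmf p ?q))"
    by simp
  also have "measure_pmf.expectation (pair_pmf p ?q) (\<lambda>x. real (snd x)) =
      mean (map_pmf snd (pair_pmf p ?q))"
    by simp
  finally show ?case
    using Cons by (simp only: map_fst_pair_pmf map_snd_pair_pmf) simp
qed

text \<open>A full set returns at once, so a set that is passed on unchanged still fits into the
  next, smaller range. This keeps the sample space of the next level nonempty, as
  \<open>pmf_of_set\<close> requires.\<close>

lemma mst_calls_card:
  assumes "(U, U') \<in> set (mst_calls n \<sigma> i S S')" "S \<in> level_subsets n i l" "i \<le> max_effective_row n \<sigma>"
  shows "card U \<le> Suc n - Suc i"
proof -
  have S: "finite S" "S \<subseteq> {i..n}" "card S = l"
    using assms(2) finite_subset by (auto simp: level_subsets_def)
  have "card S \<noteq> n - i + 1"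
    using assms by (auto simp: mst_calls_def returns_at_once_def)
  moreover have "card S \<le> Suc n - i"
    using card_mono[OF _ S(2)] by simp
  moreover have "U = S - {i} \<and> i \<in> S \<or> U = S"
    using assms(1) by (auto simp: mst_calls_def Let_def split: if_splits)
  ultimately show ?thesis
    using S card_Diff_singleton[of i S] by auto
qed

lemma level_subsets_nonempty: "l \<le> Suc n - i \<Longrightarrow> level_subsets n i l \<noteq> {}"
  using zero_less_binomial[of l "Suc n - i"] card_level_subsets[of n i l] by fastforce

lemma set_pmf_mst_pair:
  assumes "l \<le> Suc n - i"
  shows "set_pmf (pair_pmf (pmf_of_set (level_subsets n i l)) (pmf_of_set (level_subsets n i l)))
    = level_subsets n i l \<times> level_subsets n i l"
  using level_subsets_nonempty[OF assms] by simp

text \<open>Finitely many pairs can be drawn and each issues finitely many calls;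
  \<open>mst_calls_card\<close> carries the bound on \<open>l\<close> to the next level.\<close>

lemma finite_mst_cost: "l \<le> Suc n - i \<Longrightarrow> finite (set_pmf (mst_cost n \<sigma> i l))"
proof (induction n \<sigma> i l rule: mst_cost.induct)
  case (1 n \<sigma> i l)
  have "finite (set_pmf (sum_list_pmf
      (map (\<lambda>(U, U'). mst_cost n \<sigma> (i + 1) (card U)) (mst_calls n \<sigma> i S S'))))"
    if "S \<in> level_subsets n i l" "S' \<in> level_subsets n i l" "\<not> max_effective_row n \<sigma> < i" for S S'
    using 1(1)[OF _ refl that(3) _ refl] mst_calls_card[of _ _ n \<sigma> i S S' l] that 
      set_pmf_mst_pair[OF 1(2)]
    by (intro finite_sum_list_pmf) (auto simp del: set_pair_pmf)
  then show ?case
    using set_pmf_mst_pair[OF 1(2)]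
    by (subst mst_cost.simps) (auto simp del: set_pair_pmf)
qed

text \<open>Law of total expectation over the drawn pair, uniform on the square of the sample space,
  followed by linearity over the list of calls.\<close>

lemma mean_mst_cost:
  assumes "l \<le> Suc n - i"
  shows "mean (mst_cost n \<sigma> i l) =
    (\<Sum>S\<in>level_subsets n i l. \<Sum>S'\<in>level_subsets n i l.
       real (mst_evals n \<sigma> i S S')
       + (if max_effective_row n \<sigma> < i then 0
          else \<Sum>(U, U')\<leftarrow>mst_calls n \<sigma> i S S'. mean (mst_cost n \<sigma> (i + 1) (card U))))
    / (real (card (level_subsets n i l)))\<^sup>2"
proof -
  let ?L = "level_subsets n i l"
  define rest where "rest = (\<lambda>S S'. if max_effective_row n \<sigma> < i then return_pmf 0
    else sum_list_pmf
      (map (\<lambda>(U, U'). mst_cost n \<sigma> (i + 1) (card U)) (mst_calls n \<sigma> i S S')))"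
  have fin_calls: "finite (set_pmf p)"
    if "p \<in> set (map (\<lambda>(U, U'). mst_cost n \<sigma> (i + 1) (card U)) (mst_calls n \<sigma> i S S'))"
      "S \<in> ?L" "\<not> max_effective_row n \<sigma> < i" for S S' p
    using that mst_calls_card[of _ _ n \<sigma> i S S' l] by (auto intro!: finite_mst_cost)
  have fin_rest: "finite (set_pmf (rest S S'))" if "S \<in> ?L" for S S'
    using fin_calls[OF _ that] unfolding rest_def by (auto intro!: finite_sum_list_pmf)
  have mean_rest: "mean (rest S S') = (if max_effective_row n \<sigma> < i then 0
      else \<Sum>(U, U')\<leftarrow>mst_calls n \<sigma> i S S'. mean (mst_cost n \<sigma> (i + 1) (card U)))"
    if "S \<in> ?L" for S S'
  proof (cases "max_effective_row n \<sigma> < i")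
    case False
    show ?thesis
      using False
      by (simp only: rest_def if_False mean_sum_list_pmf[OF fin_calls[OF _ that False]])
         (simp add: o_def case_prod_unfold)
  qed (simp add: rest_def)
  have mean_add: "mean (map_pmf ((+) a) p) = real a + mean p" if "finite (set_pmf p)" for a p
    using that by (simp add: integrable_measure_pmf_finite)
  \<comment> \<open>Absorbing the evaluations of the call itself into \<open>map_pmf\<close> leaves
    a single bind over the drawn pair.\<close>
  have cost: "mst_cost n \<sigma> i l = pair_pmf (pmf_of_set ?L) (pmf_of_set ?L) \<bind>
      (\<lambda>(S, S'). map_pmf ((+) (mst_evals n \<sigma> i S S')) (rest S S'))"
    by (subst mst_cost.simps) (simp add: rest_def map_pmf_def)
  have "mean (mst_cost n \<sigma> i l) = (\<Sum>x\<in>?L \<times> ?L. pmf (pair_pmf (pmf_of_set ?L) (pmf_of_set ?L)) x *\<^sub>R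
      mean (case x of (S, S') \<Rightarrow> map_pmf ((+) (mst_evals n \<sigma> i S S')) (rest S S')))"
    unfolding cost using fin_rest set_pmf_mst_pair[OF assms]
    by (intro pmf_expectation_bind) auto
  also have "\<dots> = (\<Sum>(S, S')\<in>?L \<times> ?L.
      (real (mst_evals n \<sigma> i S S') + mean (rest S S')) / (real (card ?L))\<^sup>2)"
    using fin_rest
    by (intro sum.cong refl)
       (auto simp: pmf_pair pmf_of_set[OF level_subsets_nonempty[OF assms]] mean_add
         power2_eq_square simp del: integral_map_pmf)
  also have "\<dots> = (\<Sum>S\<in>?L. \<Sum>S'\<in>?L.
      real (mst_evals n \<sigma> i S S') + mean (rest S S')) / (real (card ?L))\<^sup>2"
    by (simp add: sum.cartesian_product[symmetric] sum_divide_distrib)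
  finally show ?thesis
    by (simp add: mean_rest)
qed

section \<open>The recursion for the mean cost\<close>

lemma mean_mst_cost_final:
  assumes "i = Suc (max_effective_row n \<sigma>)" "l \<le> Suc n - i"
  shows "mean (mst_cost n \<sigma> i l) = real l"
proof -
  have "card (level_subsets n i l) \<noteq> 0"
    using level_subsets_nonempty[OF assms(2)] by simp
  \<comment> \<open>For \<open>l = 0\<close> the call returns at once, at cost \<open>0 = l\<close>;
    the early return for full sets is confined to levels up to \<open>r\<close>.\<close>
  moreover have "mst_evals n \<sigma> i S S' = l" if "S \<in> level_subsets n i l" for S S'
    using that assms by (auto simp: mst_evals_def returns_at_once_def level_subsets_def Let_def)
  ultimately show ?thesis
    using assms by (subst mean_mst_cost) (auto simp: power2_eq_square)
qed

text \<open>The default values of \<open>rho\<close> and \<open>rho_bar\<close> mirror the calls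
  that return at once.\<close>

lemma reduction_factor_trivial:
  assumes "l = 0 \<or> l = Suc n - i"  "i \<le> n"
  shows "reduction_factor n \<sigma> \<beta> i (int l) = 0"
  using assms by (auto simp: reduction_factor_def rho_def rho_bar_def)

text \<open>Whether \<open>i\<close> lies in \<open>S\<close> selects the branch, and within a
  branch the expected cost depends on \<open>S'\<close> alone. Independence therefore gives a
  product of probabilities: \<open>\<rho>\<close> times \<open>\<rho>\<close> for each possible hit
  in the element branch, \<open>1 - \<rho>\<close> times the gap in the other one. The factor
  \<open>c + 1\<close> counts possible calls, \<open>c\<close> the switch images.\<close>

lemma mean_mst_cost_step:
  assumes st: "switch_table n G \<sigma>" and i: "1 \<le> i" "i \<le> max_effective_row n \<sigma>" "i \<le> n"
    and l: "l \<le> Suc n - i"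
  defines "c \<equiv> real (row_count n \<sigma> i)"
  shows "mean (mst_cost n \<sigma> i l) =
    reduction_factor n \<sigma> True i (int l)
      * ((c + 1) * mean (mst_cost n \<sigma> (Suc i) (l - 1)) + c * real (l - 1))
    + reduction_factor n \<sigma> False i (int l)
      * ((c + 1) * mean (mst_cost n \<sigma> (Suc i) l) + c * real l)"
proof (cases "l = 0 \<or> l = Suc n - i")
  case True
  then have "returns_at_once n \<sigma> i S" if "S \<in> level_subsets n i l" for S
    using that i by (auto simp: returns_at_once_def level_subsets_def)
  then have "mst_evals n \<sigma> i S S' = 0" "mst_calls n \<sigma> i S S' = []"
    if "S \<in> level_subsets n i l" for S S'
    using that by (auto simp: mst_evals_def mst_calls_def)
  then show ?thesis
    using reduction_factor_trivial[OF True i(3)]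
    by (simp add: mean_mst_cost[OF l] leD[OF i(2)])
next
  case False
  let ?J = "row_switches n \<sigma> i" and ?L = "level_subsets n i l"
  define M where "M l' = mean (mst_cost n \<sigma> (Suc i) l')" for l'
  \<comment> \<open>\<open>A\<close> is the cost if \<open>i\<close> lies in \<open>S\<close>: a hit
    in the row costs \<open>l - 1\<close> evaluations, and every hit, including \<open>i\<close>,
    causes a call. \<open>B\<close> is the cost otherwise: one hit stops the call, no hit causes all
    \<open>c + 1\<close> calls and \<open>c\<close> images.\<close>
  define A where "A S' = real (card (?J \<inter> S')) * real (l - 1)
    + real (card (insert i ?J \<inter> S')) * M (l - 1)" for S'
  define B where "B S' = of_bool (insert i ?J \<inter> S' = {}) * ((c + 1) * M l + c * real l)" for S'
  define C where "C = real (card ?L)"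
  have J: "?J \<subseteq> {i<..n}"
    using row_switches_subset[OF st] i by simp
  have fin: "finite ?J" "i \<notin> ?J"
    using J by (auto simp: row_switches_def)
  have l': "0 < l" "l < Suc n - i"
    using False l by auto
  have C: "C \<noteq> 0"
    using level_subsets_nonempty[OF l] by (simp add: C_def)
  have \<rho>: "rho n i (int l) = real l / real (Suc n - i)" "rho_bar n i (int l) = 1 - rho n i (int l)"
    using l' i by (auto simp: rho_def rho_bar_def)
  have cost: "real (mst_evals n \<sigma> i S S')
       + (if max_effective_row n \<sigma> < i then 0
          else \<Sum>(U, U')\<leftarrow>mst_calls n \<sigma> i S S'. mean (mst_cost n \<sigma> (i + 1) (card U)))
      = of_bool (i \<in> S) * A S' + (1 - of_bool (i \<in> S)) * B S'"
    if S: "S \<in> ?L" "S' \<in> ?L" for S S'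
  proof -
    have fS: "finite S" "card S = l"
      using S finite_subset by (auto simp: level_subsets_def)
    have nr: "\<not> returns_at_once n \<sigma> i S"
      using fS l' by (auto simp: returns_at_once_def)
    show ?thesis
    proof (cases "i \<in> S")
      case True
      moreover have "card (S - {i}) = l - 1"
        using True fS by simp
      ultimately show ?thesis
        using nr fin i by (simp add: mst_evals_def mst_calls_def Let_def o_def A_def M_def
            sum_list_triv distrib_right)
    next
      case False
      then show ?thesis
        using nr fin i fS by (simp add: mst_evals_def mst_calls_def Let_def o_def B_def M_def c_def
            sum_list_triv algebra_simps)
    qed
  qed
  have sum_A: "(\<Sum>S'\<in>?L. A S') =
      rho n i (int l) * ((c + 1) * M (l - 1) + c * real (l - 1)) * C"
  proof -
    have "(\<Sum>S'\<in>?L. A S') = (\<Sum>S'\<in>?L. real (card (?J \<inter> S'))) * real (l - 1)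
        + (\<Sum>S'\<in>?L. real (card (insert i ?J \<inter> S'))) * M (l - 1)"
      by (simp add: A_def sum.distrib sum_distrib_right)
    also have "(\<Sum>S'\<in>?L. real (card (?J \<inter> S'))) = c * rho n i (int l) * C"
      using J by (subst sum_card_Int_level_subsets) (auto simp: \<rho> c_def C_def)
    also have "(\<Sum>S'\<in>?L. real (card (insert i ?J \<inter> S'))) = (c + 1) * rho n i (int l) * C"
      using J fin i by (subst sum_card_Int_level_subsets) (auto simp: \<rho> c_def C_def)
    finally show ?thesis
      by (simp add: algebra_simps)
  qed
  have sum_B: "(\<Sum>S'\<in>?L. B S') =
      transitivity_gap n \<sigma> i (int l) * ((c + 1) * M l + c * real l) * C"
  proof -
    have "(\<Sum>S'\<in>?L. B S') = real (card {S'\<in>?L. insert i ?J \<inter> S' = {}}) * ((c + 1) * M l + c * real l)"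
      unfolding B_def sum_distrib_right[symmetric] by (simp add: Int_def)
    then show ?thesis
      using card_level_subsets_disjoint[OF J i(3) l] by (simp add: C_def)
  qed
  have sum_S: "(\<Sum>S\<in>?L. of_bool (i \<in> S)) = rho n i (int l) * C"
    using card_level_subsets_member[of i i n l] i by (simp add: \<rho> C_def Int_def)
  have "mean (mst_cost n \<sigma> i l) =
      (\<Sum>S\<in>?L. \<Sum>S'\<in>?L. of_bool (i \<in> S) * A S' + (1 - of_bool (i \<in> S)) * B S') / C\<^sup>2"
    by (simp only: mean_mst_cost[OF l] C_def cost cong: sum.cong)
  \<comment> \<open>\<open>S\<close> enters only through an indicator, so the double sum factorizes;
    the difference from \<open>C\<close> counts the sets \<open>S\<close> avoiding
    \<open>i\<close>.\<close>
  also have "\<dots> = ((\<Sum>S\<in>?L. of_bool (i \<in> S)) * (\<Sum>S'\<in>?L. A S')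
      + (C - (\<Sum>S\<in>?L. of_bool (i \<in> S))) * (\<Sum>S'\<in>?L. B S')) / C\<^sup>2"
    by (simp only: sum.distrib sum_distrib_left[symmetric] sum_distrib_right[symmetric]
        sum_subtractf C_def) simp
  also have "\<dots> = (rho n i (int l))\<^sup>2 * ((c + 1) * M (l - 1) + c * real (l - 1))
      + rho_bar n i (int l) * transitivity_gap n \<sigma> i (int l) * ((c + 1) * M l + c * real l)"
    unfolding sum_S sum_A sum_B \<rho>(2) using C by (simp add: field_simps power2_eq_square)
  finally show ?thesis
    by (simp add: reduction_factor_def M_def)
qed

section \<open>Sums over branch-selection vectors\<close>

text \<open>The inner sum of the claim, with the starting level free so that a recursion over levels
  can be stated.\<close>

definition level_weight :: "nat \<Rightarrow> (nat \<Rightarrow> nat \<Rightarrow> nat \<Rightarrow> nat) \<Rightarrow> nat \<Rightarrow> int \<Rightarrow> nat \<Rightarrow> real" where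
  "level_weight n \<sigma> i l p =
    (\<Sum>b\<in>branch_vectors p. branch_weight n \<sigma> i l b * real_of_int (node_weight l b))"

text \<open>After the first decision the walk continues one level higher, with the cardinality
  lowered by one exactly for an element branch.\<close>

lemma branch_weight_Cons:
  "branch_weight n \<sigma> i l (\<beta> # b) =
    reduction_factor n \<sigma> \<beta> i l * branch_weight n \<sigma> (Suc i) (l - of_bool \<beta>) b"
proof -
  \<comment> \<open>Shifting the index by one turns it into a list position, so the head is the
    factor at \<open>t = 0\<close>.\<close>
  have "branch_weight n \<sigma> i l (\<beta> # b) =
      (\<Prod>t\<in>{0..length b}. reduction_factor n \<sigma> ((\<beta> # b) ! t) (i + t)
        (l - int (ones (take t (\<beta> # b)))))"
    unfolding branch_weight_def by (rule prod.reindex_cong[where l = Suc]) auto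
  also have "\<dots> = reduction_factor n \<sigma> \<beta> i l *
      (\<Prod>t\<in>{1..length b}. reduction_factor n \<sigma> ((\<beta> # b) ! t) (i + t)
        (l - int (ones (take t (\<beta> # b)))))"
    by (subst prod.atLeast_Suc_atMost) (auto simp: ones_def)
  also have "(\<Prod>t\<in>{1..length b}. reduction_factor n \<sigma> ((\<beta> # b) ! t) (i + t)
        (l - int (ones (take t (\<beta> # b))))) = branch_weight n \<sigma> (Suc i) (l - of_bool \<beta>) b"
    unfolding branch_weight_def
    by (intro prod.cong refl) (auto simp: ones_def nth_Cons' take_Cons' algebra_simps)
  finally show ?thesis .
qed

lemma node_weight_Cons: "node_weight l (\<beta> # b) = node_weight (l - of_bool \<beta>) b"
  by (auto simp: node_weight_def ones_def algebra_simps)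

lemma level_weight_0: "level_weight n \<sigma> i l 0 = real_of_int (max l 0)"
  by (simp add: level_weight_def branch_vectors_def branch_weight_def node_weight_def ones_def)

text \<open>The vectors split by their first coordinate into two disjoint copies of the shorter
  ones.\<close>

lemma level_weight_Suc:
  "level_weight n \<sigma> i l (Suc p) =
    reduction_factor n \<sigma> True i l * level_weight n \<sigma> (Suc i) (l - 1) p
    + reduction_factor n \<sigma> False i l * level_weight n \<sigma> (Suc i) l p"
proof -
  have fin: "finite (branch_vectors p)"
    unfolding branch_vectors_def using finite_lists_length_eq[of "UNIV :: bool set" p] by simp
  have eq: "branch_vectors (Suc p) = (#) True ` branch_vectors p \<union> (#) False ` branch_vectors p"
    by (auto simp: branch_vectors_def length_Suc_conv)
  show ?thesis
    unfolding level_weight_def eq using fin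
    by (subst sum.union_disjoint)
       (auto simp: sum.reindex branch_weight_Cons node_weight_Cons sum_distrib_left mult.assoc)
qed

section \<open>The closed formula as a solution of the recursion\<close>

lemma kappa_pos: "0 < kappa n \<sigma> i"
  by (simp add: kappa_def)

lemma kappa_rec: "i \<le> max_effective_row n \<sigma> \<Longrightarrow> kappa n \<sigma> i = (row_count n \<sigma> i + 1) * kappa n \<sigma> (Suc i)"
  unfolding kappa_def by (subst prod.atLeast_Suc_atMost) auto

text \<open>The right-hand side of the claim for a start at level \<open>i\<close>. The first
  summand accounts for the final comparisons at level \<open>r + 1\<close>. Summand \<open>j\<close>
  accounts for the images computed in row \<open>j\<close>:
  \<open>kappa n \<sigma> i / kappa n \<sigma> (Suc j)\<close> branches lead through that row, and
  the share \<open>c / (c + 1)\<close> of them, with \<open>c\<close> the count of row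
  \<open>j\<close>, uses a switch.\<close>

definition tree_cost :: "nat \<Rightarrow> (nat \<Rightarrow> nat \<Rightarrow> nat \<Rightarrow> nat) \<Rightarrow> nat \<Rightarrow> int \<Rightarrow> real" where
  "tree_cost n \<sigma> i l =
    level_weight n \<sigma> i l (Suc (max_effective_row n \<sigma>) - i) * real (kappa n \<sigma> i)
    + (\<Sum>j\<in>{i..max_effective_row n \<sigma>}. level_weight n \<sigma> i l (Suc j - i)
        * (real (row_count n \<sigma> j) / (real (row_count n \<sigma> j) + 1))
        * (real (kappa n \<sigma> i) / real (kappa n \<sigma> (Suc j))))"

lemma tree_cost_final:
  "tree_cost n \<sigma> (Suc (max_effective_row n \<sigma>)) (int l) = real l"
  by (simp add: tree_cost_def level_weight_0 kappa_def)

text \<open>Every coefficient at level \<open>i\<close> is \<open>c + 1\<close> times the one at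
  level \<open>i + 1\<close>, and the weights split by the first coordinate. The summand
  \<open>j = i\<close> has no counterpart at level \<open>i + 1\<close> and becomes the evaluations
  made at level \<open>i\<close>.\<close>

lemma tree_cost_step:
  assumes "i \<le> max_effective_row n \<sigma>"
  defines "c \<equiv> real (row_count n \<sigma> i)"
  shows "tree_cost n \<sigma> i l =
    reduction_factor n \<sigma> True i l
      * ((c + 1) * tree_cost n \<sigma> (Suc i) (l - 1) + c * real_of_int (max (l - 1) 0))
    + reduction_factor n \<sigma> False i l
      * ((c + 1) * tree_cost n \<sigma> (Suc i) l + c * real_of_int (max l 0))"
proof -
  let ?r = "max_effective_row n \<sigma>"
  define a1 a0 where "a1 = reduction_factor n \<sigma> True i l" and "a0 = reduction_factor n \<sigma> False i l"
  define K where "K = real (kappa n \<sigma> (Suc i))"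
  \<comment> \<open>\<open>d j\<close> is the coefficient of summand \<open>j\<close> at level
    \<open>i + 1\<close>.\<close>
  define d where "d j = real (row_count n \<sigma> j) / (real (row_count n \<sigma> j) + 1)
    * (K / real (kappa n \<sigma> (Suc j)))" for j
  have K: "real (kappa n \<sigma> i) = (c + 1) * K" "K \<noteq> 0"
    using kappa_rec[OF assms(1)] kappa_pos[of n \<sigma> "Suc i"] by (auto simp: K_def c_def algebra_simps)
  have c: "c + 1 \<noteq> 0"
    by (simp add: c_def add_nonneg_eq_0_iff)
  have T: "tree_cost n \<sigma> (Suc i) l' =
      level_weight n \<sigma> (Suc i) l' (?r - i) * K
      + (\<Sum>j\<in>{Suc i..?r}. level_weight n \<sigma> (Suc i) l' (j - i) * d j)" for l'
    by (simp add: tree_cost_def K_def d_def mult.assoc)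
  have W: "level_weight n \<sigma> i l (Suc j - i) =
      a1 * level_weight n \<sigma> (Suc i) (l - 1) (j - i) + a0 * level_weight n \<sigma> (Suc i) l (j - i)"
    if "i \<le> j" for j
    using that by (simp add: Suc_diff_le level_weight_Suc a1_def a0_def)
  have "tree_cost n \<sigma> i l = level_weight n \<sigma> i l (Suc ?r - i) * ((c + 1) * K)
      + (\<Sum>j\<in>{i..?r}. level_weight n \<sigma> i l (Suc j - i) * ((c + 1) * d j))"
    by (simp add: tree_cost_def K d_def mult.assoc mult.left_commute)
  also have "(\<Sum>j\<in>{i..?r}. level_weight n \<sigma> i l (Suc j - i) * ((c + 1) * d j)) =
      level_weight n \<sigma> i l (Suc i - i) * ((c + 1) * d i)
      + (\<Sum>j\<in>{Suc i..?r}. level_weight n \<sigma> i l (Suc j - i) * ((c + 1) * d j))"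
    by (rule sum.atLeast_Suc_atMost[OF assms(1)])
  also have "(\<Sum>j\<in>{Suc i..?r}. level_weight n \<sigma> i l (Suc j - i) * ((c + 1) * d j)) =
      (\<Sum>j\<in>{Suc i..?r}. a1 * (c + 1) * (level_weight n \<sigma> (Suc i) (l - 1) (j - i) * d j)
        + a0 * (c + 1) * (level_weight n \<sigma> (Suc i) l (j - i) * d j))"
    by (intro sum.cong refl) (simp add: W algebra_simps)
  also have "\<dots> = a1 * (c + 1) * (\<Sum>j\<in>{Suc i..?r}. level_weight n \<sigma> (Suc i) (l - 1) (j - i) * d j)
        + a0 * (c + 1) * (\<Sum>j\<in>{Suc i..?r}. level_weight n \<sigma> (Suc i) l (j - i) * d j)"
    by (simp only: sum.distrib sum_distrib_left[symmetric])
  \<comment> \<open>For \<open>j = i\<close> the quotient of the \<open>kappa\<close> values in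
    \<open>d\<close> is 1.\<close>
  also have "(c + 1) * d i = c"
    using c K(2) by (simp add: d_def c_def[symmetric] K_def[symmetric])
  finally show ?thesis
    using W[OF assms(1)] W[of i]
    by (simp add: T a1_def[symmetric] a0_def[symmetric] level_weight_0 algebra_simps)
qed

text \<open>Both sides agree at level \<open>r + 1\<close> and obey the same recursion, so the
  induction descends from there.\<close>

lemma mean_mst_cost_eq_tree_cost:
  assumes st: "switch_table n G \<sigma>" and "1 \<le> i" "i \<le> Suc (max_effective_row n \<sigma>)"
    and "max_effective_row n \<sigma> < n" "l \<le> Suc n - i"
  shows "mean (mst_cost n \<sigma> i l) = tree_cost n \<sigma> i (int l)"
  using assms(3,2,5)
proof (induction i arbitrary: l rule: inc_induct)
  case base
  then show ?case
    by (simp add: mean_mst_cost_final tree_cost_final)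
next
  case (step i)
  have i: "i \<le> max_effective_row n \<sigma>" "i \<le> n"
    using step.hyps assms(4) by auto
  note rec = mean_mst_cost_step[OF st step.prems(1) i step.prems(2)]
    tree_cost_step[OF i(1), of "int l"]
  show ?case
  \<comment> \<open>The boundary cases are separate because \<open>l = Suc n - i\<close> leaves the
    range of the induction hypothesis, and for \<open>l = 0\<close> the truncated
    \<open>l - 1\<close> differs from the integer one. Both reduction factors vanish there.\<close>
  proof (cases "l = 0 \<or> l = Suc n - i")
    case True
    then show ?thesis
      unfolding rec by (simp add: reduction_factor_trivial[OF True i(2)])
  next
    case False
    then have l: "l \<le> Suc n - Suc i" "l - 1 \<le> Suc n - Suc i" "int (l - 1) = int l - 1"
      "max (int l - 1) 0 = int (l - 1)"
      using step.prems by auto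
    show ?thesis
      unfolding rec using step.IH[OF _ l(1)] step.IH[OF _ l(2)] l(3,4) by simp
  qed
qed

theorem theorem3:
  fixes n m k r :: nat
    and G :: "(nat \<Rightarrow> nat) set"
    and \<sigma> :: "nat \<Rightarrow> nat \<Rightarrow> nat \<Rightarrow> nat"
  assumes "1 \<le> m" and "m < n"
    and "subgroup G (sym_group n)"
    and "k = card G"
    and "switch_table n G \<sigma>"
    and "r = max_effective_row n \<sigma>"
  shows "typical_evals n \<sigma> m =
    (\<Sum>b\<in>branch_vectors r. branch_weight n \<sigma> 1 (int m) b * real_of_int (node_weight (int m) b)) * real k
    + (\<Sum>j\<in>{1..r}.
        (\<Sum>b\<in>branch_vectors j. branch_weight n \<sigma> 1 (int m) b * real_of_int (node_weight (int m) b))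
        * (real (row_count n \<sigma> j) / (real (row_count n \<sigma> j) + 1))
        * (real k / real (kappa n \<sigma> (j + 1))))"
proof -
  have n: "0 < n"
    using assms by simp
  have "r < n"
    using max_effective_row_less[OF assms(5) n] assms(6) by simp
  then have "typical_evals n \<sigma> m = tree_cost n \<sigma> 1 (int m)"
    unfolding typical_evals_def
    using mean_mst_cost_eq_tree_cost[OF assms(5), of 1 m] assms(2,6) by simp
  then show ?thesis
    using card_eq_kappa[OF assms(3,5) n] assms(4,6)
    by (simp add: tree_cost_def level_weight_def)
qed

end
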